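(* There exists a constant $C_1>0$ such that for every $\beta\ge1$ there is a constant $C>0$ for which the following holds. Let $N\ge512$, and let $\Phi_1,\Phi_2$ be two orthonormal bases of $\mathbb{C}^N$ with mutual incoherence $\mu$ satisfying $\mu\le 1/\sqrt{2(\beta+1)\log N}$. Let $p_1,p_2\in[0,1]$ be sampling parameters with $\min(\mathbf{E}|\Gamma_1|,\mathbf{E}|\Gamma_2|)\ge4(\beta+1)\log N$ and $$\mathbf{E}|\Gamma_1|+\mathbf{E}|\Gamma_2|\le\frac{C_1}{\mu^2\cdot((\beta+1)\log N)^{5/2}}.$$ Then with probability at least $1-C\log N\cdot N^{-\beta}$ over the random pair $(\Gamma_1,\Gamma_2)$: every signal $f\in\mathbb{C}^N$ with $\Phi_1f$ supported on $\Gamma_1$ satisfies $$\|\Phi_2f\cdot1_{\Gamma_2}\|^2\le\|f\|^2/2,$$ and vice versa, every signal $f$ with $\Phi_2f$ supported on $\Gamma_2$ satisfies $\|\Phi_1f\cdot1_{\Gamma_1}\|^2\le\|f\|^2/2$. As a result, with this probability there is no nonzero $f$ such that $\Phi_1f$ is supported on $\Gamma_1$ and $\Phi_2f$ is supported on $\Gamma_2$.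
   Context: For an orthonormal basis $\Phi_i$ of $\mathbb{C}^N$, $\Phi_if\in\mathbb{C}^N$ here denotes the vector of coefficients of $f$ in the basis $\Phi_i$, indexed by $\{0,\dots,N-1\}$. $1_S$ is the indicator function of $S$ (pointwise multiplication), and $\|\cdot\|$ is the Euclidean norm. The mutual incoherence is $\mu=\mu(\Phi_1,\Phi_2)=\max_{\phi\in\Phi_1,\psi\in\Phi_2}|\langle\phi,\psi\rangle|$. Probability model: $I_1(j)$ and $I_2(j)$, $j=0,\dots,N-1$, are two independent sequences of i.i.d. Bernoulli random variables with parameters $p_1$ and $p_2$ respectively; $\Gamma_1=\{j:I_1(j)=1\}$ and $\Gamma_2=\{j:I_2(j)=1\}$, so $\mathbf{E}|\Gamma_i|=p_iN$. $\log$ is the natural logarithm. *)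

theory Defs
  imports "HOL-Probability.Probability" "Jordan_Normal_Form.VS_Connect"
    "Jordan_Normal_Form.Conjugate"
begin

unbundle no vec_syntax
unbundle no inner_syntax
hide_const (open) Finite_Cartesian_Product.vec

text \<open>
  The dimension is quantified inside the theorem, so the space of complex N-tuples is
  \<^term>\<open>carrier_vec N :: complex vec set\<close>, and a basis is a family of vectors
  of which only the members with index below \<^term>\<open>N\<close> matter.
  The inner product \<^term>\<open>v \<bullet>c w\<close> is conjugate-linear in \<^term>\<open>w\<close>.
\<close>

definition orthonormal_basis :: "nat \<Rightarrow> (nat \<Rightarrow> complex vec) \<Rightarrow> bool" where
  "orthonormal_basis N \<Phi> \<longleftrightarrow>
     vectorspace.basis class_ring (module_vec TYPE(complex) N) (\<Phi> ` {..<N}) \<and>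
     (\<forall>i<N. \<forall>j<N. \<Phi> i \<bullet>c \<Phi> j = (if i = j then 1 else 0))"

definition coeffs_in :: "nat \<Rightarrow> (nat \<Rightarrow> complex vec) \<Rightarrow> complex vec \<Rightarrow> complex vec" where
  "coeffs_in N \<Phi> f = vec N (\<lambda>k. f \<bullet>c \<Phi> k)"

definition vec_l2norm :: "complex vec \<Rightarrow> real" where
  "vec_l2norm v = L2_set (\<lambda>k. cmod (v $ k)) {..<dim_vec v}"

definition restrict_to :: "nat set \<Rightarrow> complex vec \<Rightarrow> complex vec" where
  "restrict_to S v = vec (dim_vec v) (\<lambda>k. v $ k * indicator S k)"

definition vec_supported_on :: "complex vec \<Rightarrow> nat set \<Rightarrow> bool" where
  "vec_supported_on v S \<longleftrightarrow> {k. k < dim_vec v \<and> v $ k \<noteq> 0} \<subseteq> S"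

definition mutual_incoherence ::
    "nat \<Rightarrow> (nat \<Rightarrow> complex vec) \<Rightarrow> (nat \<Rightarrow> complex vec) \<Rightarrow> real" where
  "mutual_incoherence N \<Phi> \<Psi> = Max {cmod (\<phi> \<bullet>c \<psi>) | \<phi> \<psi>. \<phi> \<in> \<Phi> ` {..<N} \<and> \<psi> \<in> \<Psi> ` {..<N}}"

definition bernoulli_seq :: "nat \<Rightarrow> real \<Rightarrow> (nat \<Rightarrow> bool) pmf" where
  "bernoulli_seq N p = Pi_pmf {..<N} False (\<lambda>_. bernoulli_pmf p)"

definition selected :: "nat \<Rightarrow> (nat \<Rightarrow> bool) \<Rightarrow> nat set" where
  "selected N I = {j. j < N \<and> I j}"

definition random_subset :: "nat \<Rightarrow> real \<Rightarrow> nat set pmf" where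
  "random_subset N p = map_pmf (selected N) (bernoulli_seq N p)"

definition expected_size :: "nat set pmf \<Rightarrow> real" where
  "expected_size G = measure_pmf.expectation G (\<lambda>\<Gamma>. real (card \<Gamma>))"

text \<open>
  The inner products in \<^const>\<open>coeffs_in\<close> are indeed the coefficients of the
  expansion of a vector in the basis.
\<close>

lemma coeffs_in_expansion:
  assumes "orthonormal_basis N \<Phi>" and f: "f \<in> carrier_vec N" and "i < N"
  shows "f $ i = (\<Sum>k<N. coeffs_in N \<Phi> f $ k * \<Phi> k $ i)"
proof -
  interpret V: vec_space "TYPE(complex)" N .
  have c: "\<Phi> k \<in> carrier_vec N" if "k < N" for k
    using assms(1) that unfolding orthonormal_basis_def V.basis_def by auto
  define A where "A = mat N N (\<lambda>(i,k). \<Phi> k $ i)"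
  define B where "B = mat N N (\<lambda>(k,i). cnj (\<Phi> k $ i))"
  have AB: "A \<in> carrier_mat N N" "B \<in> carrier_mat N N" by (auto simp: A_def B_def)
  have on: "(\<Sum>m = 0..<N. cnj (\<Phi> k $ m) * \<Phi> l $ m) = (if k = l then 1 else 0)"
    if "k < N" "l < N" for k l
  proof -
    have "\<Phi> l \<bullet>c \<Phi> k = (if l = k then 1 else 0)"
      using assms(1) that unfolding orthonormal_basis_def by blast
    thus ?thesis using c[OF that(1)] c[OF that(2)]
      by (auto simp: scalar_prod_def mult.commute)
  qed
  have "B * A = 1\<^sub>m N"
    by (rule eq_matI) (auto simp: A_def B_def scalar_prod_def on)
  hence "A * B = 1\<^sub>m N" using AB mat_mult_left_right_inverse by blast
  hence "f = A *\<^sub>v (B *\<^sub>v f)"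
    using AB f by (metis assoc_mult_mat_vec one_mult_mat_vec)
  moreover have "B *\<^sub>v f = coeffs_in N \<Phi> f"
    using f by (intro eq_vecI) (auto simp: carrier_vecD[OF c] B_def coeffs_in_def scalar_prod_def mult.commute)
  ultimately have "f $ i = (A *\<^sub>v coeffs_in N \<Phi> f) $ i" by simp
  thus ?thesis using \<open>i < N\<close>
    by (simp add: A_def coeffs_in_def scalar_prod_def mult.commute lessThan_atLeast0)
qed

end

theory Submission
  imports Defs
begin

text \<open>
Let \<open>f\<close> be a signal whose coefficients in the first basis live on \<open>\<Gamma>1\<close>, and let \<open>u k\<close> be the vector of the coefficients on
\<open>\<Gamma>1\<close> of the \<open>k\<close>-th member of the second basis. The energy of \<open>f\<close> on \<open>\<Gamma>2\<close> is the quadratic form of the random operator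
\<open>S = (\<Sum>k\<in>\<Gamma>2. u k (u k)\<^sup>*)\<close>. The \<open>u k\<close> form a tight frame of vectors of squared norm at most
\<open>R = card \<Gamma>1 * \<mu>\<^sup>2\<close>, so \<open>S\<close> has expectation \<open>p2\<close> times the identity. The claim is that its largest
eigenvalue exceeds \<open>1 / 2\<close> only with small probability.

Fix \<open>\<Gamma>1\<close> and bound the expected trace of the power \<open>S ^ L\<close> for an odd \<open>L\<close> of order \<open>(\<beta> + 1) * ln N\<close>. The trace is
\<open>(\<Sum>k\<in>\<Gamma>2. \<langle>S ^ (L - 1) (u k), u k\<rangle>)\<close>. In the summand at \<open>k\<close>, split off the rank-one term of \<open>S\<close> that belongs to
\<open>k\<close>: this gives products of moments \<open>\<langle>S' ^ a (u k), u k\<rangle>\<close> of the operator \<open>S'\<close> without \<open>k\<close>. Moments of a positive operator are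
log-convex, so all but one factor of a product can be merged into powers of \<open>R\<close>
(\<open>renewal_binomial_bound\<close>, \<open>moment_insert_le\<close>). What remains is independent of whether \<open>k\<close> was selected,
and exchanging sets with and without \<open>k\<close> (\<open>random_subset_exchange\<close>) yields a recursion between expected
traces (\<open>expectation_power_trace_Suc_le\<close>), with the frame property turning the sums over all \<open>k\<close> into traces again
(\<open>power_trace_Suc\<close>). It shows that \<open>S ^ L\<close> has expected trace at most \<open>N * K ^ L\<close> with \<open>K = 1 / 8\<close>, and
Markov's inequality finishes the argument, because an eigenvalue above \<open>1 / 2\<close> makes the trace of \<open>S ^ L\<close> at least
\<open>2 powr (- L)\<close> (\<open>power_trace_ge\<close>).

The size of \<open>\<Gamma>1\<close> is controlled by a Chernoff bound, and the reverse direction follows by exchanging the two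
bases. A signal supported on \<open>\<Gamma>1\<close> in the first basis and on \<open>\<Gamma>2\<close> in the second has its whole energy on \<open>\<Gamma>2\<close>, hence at most half of it, and vanishes.
\<close>

section \<open>Log-convex sequences\<close>

text \<open>
The quotients \<open>y (n + 1) / y n\<close> of a log-convex sequence increase. In the cross-multiplied form used
here zero terms do no harm, because a zero of \<open>y\<close> forces all later terms to be zero.
\<close>
lemma log_convex_ratio:
  fixes y :: "nat \<Rightarrow> real"
  assumes nonneg: "\<And>n. 0 \<le> y n" and log_convex: "\<And>n. (y (Suc n))\<^sup>2 \<le> y n * y (n + 2)"
  shows "y (Suc a) * y (a + d) \<le> y a * y (Suc (a + d))"
proof (induction d)
  case 0
  show ?case by simp
next
  case (Suc d)
  let ?c = "a + d"
  show ?case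
  proof (cases "y ?c = 0")
    case True
    then have "y (Suc ?c) = 0"
      using log_convex[of ?c] by simp
    then show ?thesis by (simp add: nonneg)
  next
    case False
    then have pos: "0 < y ?c" using nonneg[of ?c] by simp
    have "y ?c * (y (Suc a) * y (Suc ?c)) = (y (Suc a) * y ?c) * y (Suc ?c)" by simp
    also have "\<dots> \<le> (y a * y (Suc ?c)) * y (Suc ?c)"
      using Suc.IH by (rule mult_right_mono) (rule nonneg)
    also have "\<dots> = y a * (y (Suc ?c))\<^sup>2" by (simp add: power2_eq_square)
    also have "\<dots> \<le> y a * (y ?c * y (?c + 2))"
      using log_convex by (rule mult_left_mono) (rule nonneg)
    also have "\<dots> = y ?c * (y a * y (?c + 2))" by simp
    finally have "y (Suc a) * y (Suc ?c) \<le> y a * y (?c + 2)"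
      using pos by (simp only: mult_le_cancel_left_pos)
    then show ?thesis by simp
  qed
qed

text \<open>
For the moments \<open>y n = E (X ^ n)\<close> of a nonnegative random variable this is Chebyshev's association
inequality \<open>E (X ^ a) * E (X ^ c) \<le> E 1 * E (X ^ (a + c))\<close>. Log-convexity suffices: moving one step
from the smaller index to the larger one does not decrease the product.
\<close>
lemma log_convex_supermult:
  fixes y :: "nat \<Rightarrow> real"
  assumes nonneg: "\<And>n. 0 \<le> y n" and log_convex: "\<And>n. (y (Suc n))\<^sup>2 \<le> y n * y (n + 2)"
  shows "y a * y c \<le> y 0 * y (a + c)"
proof -
  have *: "y a * y c \<le> y 0 * y (a + c)" if "a \<le> c" for a c
    using that
  proof (induction a arbitrary: c)
    case (Suc a)
    then have "y (Suc a) * y (a + (c - a)) \<le> y a * y (Suc (a + (c - a)))"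
      by (intro log_convex_ratio nonneg log_convex)
    also have "\<dots> \<le> y 0 * y (a + Suc c)"
      using Suc.IH[of "Suc c"] Suc.prems by simp
    finally show ?case using Suc.prems by simp
  qed simp
  show ?thesis
    using *[of a c] *[of c a] by (cases "a \<le> c") (simp_all add: ac_simps)
qed

lemma log_convex_geometric:
  fixes y :: "nat \<Rightarrow> real"
  assumes nonneg: "\<And>n. 0 \<le> y n" and log_convex: "\<And>n. (y (Suc n))\<^sup>2 \<le> y n * y (n + 2)"
    and pos: "0 < y 0" and first: "\<theta> * y 0 \<le> y 1" and "0 \<le> \<theta>"
  shows "\<theta> ^ n * y 0 \<le> y n"
proof (induction n)
  case (Suc n)
  have "\<theta> ^ Suc n * y 0 = \<theta> * (\<theta> ^ n * y 0)" by simp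
  also have "\<dots> \<le> \<theta> * y n" using Suc.IH \<open>0 \<le> \<theta>\<close> by (rule mult_left_mono)
  also have "\<dots> \<le> y (Suc n)"
  proof -
    have "y 0 * (\<theta> * y n) \<le> y 1 * y n"
      using mult_right_mono[OF first nonneg[of n]] by (simp add: ac_simps)
    also have "\<dots> \<le> y 0 * y (Suc n)"
      using log_convex_ratio[of y 0 n] nonneg log_convex by simp
    finally show ?thesis using pos by (simp only: mult_le_cancel_left_pos)
  qed
  finally show ?case .
qed simp

text \<open>
Unrolling the recursion turns \<open>x n\<close> into a sum of products \<open>y a0 * ... * y ar\<close> with
\<open>a0 + ... + ar = n - r\<close>. By supermultiplicativity each product is at most \<open>R ^ r * y (n - r)\<close>, and there are
\<open>n choose r\<close> of them; the induction does the counting by the hockey-stick identity.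
\<close>
lemma renewal_binomial_bound:
  fixes x y :: "nat \<Rightarrow> real"
  assumes y_nonneg: "\<And>n. 0 \<le> y n"
    and y_log_convex: "\<And>n. (y (Suc n))\<^sup>2 \<le> y n * y (n + 2)"
    and y0: "y 0 \<le> R"
    and renewal: "\<And>n. x n = y n + (\<Sum>i<n. x i * y (n - Suc i))"
  shows "x n \<le> (\<Sum>r\<le>n. real (n choose r) * R ^ r * y (n - r))"
proof (induction n rule: less_induct)
  case (less n)
  have R: "0 \<le> R" using y0 y_nonneg[of 0] by linarith
  have step: "x i * y (n - Suc i) \<le> (\<Sum>r<n. real (i choose r) * R ^ Suc r * y (n - Suc r))"
    if i: "i < n" for i
  proof -
    have "x i * y (n - Suc i) \<le> (\<Sum>r\<le>i. real (i choose r) * R ^ r * y (i - r)) * y (n - Suc i)"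
      using less.IH[OF i] by (rule mult_right_mono) (rule y_nonneg)
    also have "\<dots> = (\<Sum>r\<le>i. real (i choose r) * R ^ r * (y (i - r) * y (n - Suc i)))"
      by (simp add: sum_distrib_right mult.assoc)
    also have "\<dots> \<le> (\<Sum>r\<le>i. real (i choose r) * R ^ r * (R * y (n - Suc r)))"
    proof (intro sum_mono mult_left_mono)
      fix r assume r: "r \<in> {..i}"
      have "y (i - r) * y (n - Suc i) \<le> y 0 * y (i - r + (n - Suc i))"
        by (intro log_convex_supermult y_nonneg y_log_convex)
      also have "i - r + (n - Suc i) = n - Suc r" using r i by auto
      also have "y 0 * y (n - Suc r) \<le> R * y (n - Suc r)"
        using y0 by (rule mult_right_mono) (rule y_nonneg)
      finally show "y (i - r) * y (n - Suc i) \<le> R * y (n - Suc r)" .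
    qed (use R in auto)
    also have "\<dots> = (\<Sum>r\<le>i. real (i choose r) * R ^ Suc r * y (n - Suc r))"
      by (simp add: ac_simps)
    also have "\<dots> = (\<Sum>r<n. real (i choose r) * R ^ Suc r * y (n - Suc r))"
      using i by (intro sum.mono_neutral_left) (auto simp: binomial_eq_0)
    finally show ?thesis .
  qed
  have "x n \<le> y n + (\<Sum>i<n. \<Sum>r<n. real (i choose r) * R ^ Suc r * y (n - Suc r))"
    unfolding renewal[of n] using step by (intro add_left_mono sum_mono) simp
  also have "(\<Sum>i<n. \<Sum>r<n. real (i choose r) * R ^ Suc r * y (n - Suc r)) =
      (\<Sum>r<n. real (\<Sum>i<n. i choose r) * R ^ Suc r * y (n - Suc r))"
    by (subst sum.swap) (simp add: sum_distrib_right)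
  also have "\<dots> = (\<Sum>r<n. real (n choose Suc r) * R ^ Suc r * y (n - Suc r))"
  proof (intro sum.cong refl)
    fix r assume "r \<in> {..<n}"
    then have "{..<n} = {..n - 1}" "Suc (n - 1) = n" by auto
    then show "real (\<Sum>i<n. i choose r) * R ^ Suc r * y (n - Suc r) =
        real (n choose Suc r) * R ^ Suc r * y (n - Suc r)"
      using sum_choose_upper[of r "n - 1"] by simp
  qed
  also have "y n + \<dots> = (\<Sum>r\<le>n. real (n choose r) * R ^ r * y (n - r))"
    by (simp add: sum.atMost_shift)
  finally show ?case .
qed

section \<open>Moments of frame operators\<close>

lemma norm_sum_mult_cnj_le:
  fixes a b :: "'a \<Rightarrow> complex"
  shows "(cmod (\<Sum>i\<in>A. a i * cnj (b i)))\<^sup>2 \<le> (\<Sum>i\<in>A. (cmod (a i))\<^sup>2) * (\<Sum>i\<in>A. (cmod (b i))\<^sup>2)"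
proof -
  have "cmod (\<Sum>i\<in>A. a i * cnj (b i)) \<le> (\<Sum>i\<in>A. cmod (a i) * cmod (b i))"
    by (rule order.trans[OF norm_sum]) (simp add: norm_mult)
  then have "(cmod (\<Sum>i\<in>A. a i * cnj (b i)))\<^sup>2 \<le> (\<Sum>i\<in>A. cmod (a i) * cmod (b i))\<^sup>2"
    by (rule power_mono) simp
  also have "\<dots> \<le> (\<Sum>i\<in>A. (cmod (a i))\<^sup>2) * (\<Sum>i\<in>A. (cmod (b i))\<^sup>2)"
    by (rule Cauchy_Schwarz_ineq_sum)
  finally show ?thesis .
qed

text \<open>
The \<open>n\<close>-th moment at \<open>x\<close> is that of the spectral measure at \<open>x\<close> of the positive operator
\<open>S = (\<Sum>k\<in>T. u k (u k)\<^sup>*)\<close>, the frame operator of the vectors selected by \<open>T\<close>. Vectors are functions of which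
only the values on \<open>J\<close> count, so that families over index sets of varying size live in a single type.
\<close>
locale vector_family =
  fixes J :: "'j set" and u :: "'k \<Rightarrow> 'j \<Rightarrow> complex"
begin

definition ip :: "('j \<Rightarrow> complex) \<Rightarrow> ('j \<Rightarrow> complex) \<Rightarrow> complex" where
  "ip x y = (\<Sum>j\<in>J. x j * cnj (y j))"

definition frame_op :: "'k set \<Rightarrow> ('j \<Rightarrow> complex) \<Rightarrow> ('j \<Rightarrow> complex)" where
  "frame_op T x = (\<lambda>j. \<Sum>k\<in>T. ip x (u k) * u k j)"

definition moment :: "nat \<Rightarrow> 'k set \<Rightarrow> ('j \<Rightarrow> complex) \<Rightarrow> real" where
  "moment n T x = Re (ip ((frame_op T ^^ n) x) x)"

lemma cnj_ip: "cnj (ip x y) = ip y x"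
  by (simp add: ip_def mult.commute)

lemma ip_self: "ip x x = of_real (\<Sum>j\<in>J. (cmod (x j))\<^sup>2)"
  by (simp add: ip_def flip: complex_norm_square)

lemma ip_add_scale_left: "ip (\<lambda>j. x j + c * z j) y = ip x y + c * ip z y"
  by (simp add: ip_def sum.distrib sum_distrib_left algebra_simps)

lemma ip_sum_left: "ip (\<lambda>j. \<Sum>k\<in>T. c k * z k j) y = (\<Sum>k\<in>T. c k * ip (z k) y)"
  unfolding ip_def sum_distrib_right sum_distrib_left
  by (subst sum.swap) (simp add: mult.assoc)

lemma ip_frame_op: "ip (frame_op T x) y = (\<Sum>k\<in>T. ip x (u k) * cnj (ip y (u k)))"
  by (simp add: frame_op_def ip_sum_left cnj_ip)

lemma frame_op_self_adjoint: "ip (frame_op T x) y = ip x (frame_op T y)"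
proof -
  have "ip x (frame_op T y) = cnj (ip (frame_op T y) x)" by (simp add: cnj_ip)
  then show ?thesis by (simp add: ip_frame_op mult.commute)
qed

lemma frame_op_funpow_self_adjoint:
  "ip ((frame_op T ^^ n) x) y = ip x ((frame_op T ^^ n) y)"
  by (induction n arbitrary: x y) (simp_all add: frame_op_self_adjoint funpow_swap1)

lemma ip_funpow_add:
  "ip ((frame_op T ^^ (m + n)) x) y = ip ((frame_op T ^^ m) x) ((frame_op T ^^ n) y)"
  by (subst add.commute) (simp add: funpow_add frame_op_funpow_self_adjoint)

text \<open>
The even and odd powers of \<open>S\<close> are handled separately: \<open>\<langle>S ^ (2 * e) x, x\<rangle>\<close> is the square of a norm, and
\<open>\<langle>S ^ (2 * e + 1) x, x\<rangle>\<close> is the quadratic form of \<open>S\<close> at \<open>S ^ e x\<close>. Positivity and log-convexity of the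
moments come from these two formulas and the Cauchy-Schwarz inequality.
\<close>
lemma ip_funpow_even:
  "ip ((frame_op T ^^ (2 * e)) x) x = of_real (\<Sum>j\<in>J. (cmod ((frame_op T ^^ e) x j))\<^sup>2)"
  using ip_funpow_add[of e e T x x] by (simp add: mult_2 ip_self)

lemma ip_funpow_odd:
  "ip ((frame_op T ^^ Suc (2 * e)) x) x =
     of_real (\<Sum>k\<in>T. (cmod (ip ((frame_op T ^^ e) x) (u k)))\<^sup>2)"
proof -
  have "ip ((frame_op T ^^ (Suc e + e)) x) x =
      ip (frame_op T ((frame_op T ^^ e) x)) ((frame_op T ^^ e) x)"
    by (subst ip_funpow_add) simp
  then show ?thesis
    by (simp add: mult_2 ip_frame_op flip: complex_norm_square)
qed

lemma moment_nonneg: "0 \<le> moment n T x"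
  and of_real_moment: "of_real (moment n T x) = ip ((frame_op T ^^ n) x) x"
proof -
  obtain e where "n = 2 * e \<or> n = Suc (2 * e)"
    using even_two_times_div_two odd_two_times_div_two_succ
    by (metis Suc_eq_plus1)
  then show "0 \<le> moment n T x" "of_real (moment n T x) = ip ((frame_op T ^^ n) x) x"
    unfolding moment_def using ip_funpow_even[of e T x] ip_funpow_odd[of e T x]
    by (auto simp: sum_nonneg simp del: funpow.simps)
qed

lemma moment_eqI: "ip ((frame_op T ^^ n) x) x = of_real c \<Longrightarrow> moment n T x = c"
  by (simp add: moment_def)

lemmas moment_even = ip_funpow_even[THEN moment_eqI]
lemmas moment_odd = ip_funpow_odd[THEN moment_eqI]

lemma moment_log_convex: "(moment (Suc n) T x)\<^sup>2 \<le> moment n T x * moment (n + 2) T x"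
proof -
  have sq: "(moment (Suc n) T x)\<^sup>2 = (cmod (ip ((frame_op T ^^ Suc n) x) x))\<^sup>2" for n
    unfolding of_real_moment[symmetric] by simp
  obtain e where "n = 2 * e \<or> n = Suc (2 * e)"
    using even_two_times_div_two odd_two_times_div_two_succ
    by (metis Suc_eq_plus1)
  then show ?thesis
  proof
    assume n: "n = 2 * e"
    have "ip ((frame_op T ^^ Suc n) x) x = ip ((frame_op T ^^ e) x) ((frame_op T ^^ Suc e) x)"
      using ip_funpow_add[of e "Suc e" T x x] by (simp add: n mult_2)
    then have "(moment (Suc n) T x)\<^sup>2 \<le> (\<Sum>j\<in>J. (cmod ((frame_op T ^^ e) x j))\<^sup>2) *
        (\<Sum>j\<in>J. (cmod ((frame_op T ^^ Suc e) x j))\<^sup>2)"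
      unfolding sq ip_def by (simp only: norm_sum_mult_cnj_le)
    also have "\<dots> = moment (2 * e) T x * moment (2 * Suc e) T x"
      by (simp only: moment_even)
    finally show ?thesis by (simp add: n)
  next
    assume n: "n = Suc (2 * e)"
    have "ip ((frame_op T ^^ Suc n) x) x =
        (\<Sum>k\<in>T. ip ((frame_op T ^^ e) x) (u k) * cnj (ip ((frame_op T ^^ Suc e) x) (u k)))"
      using ip_funpow_add[of "Suc e" "Suc e" T x x] by (simp add: n mult_2 ip_frame_op)
    then have "(moment (Suc n) T x)\<^sup>2 \<le>
        (\<Sum>k\<in>T. (cmod (ip ((frame_op T ^^ e) x) (u k)))\<^sup>2) *
        (\<Sum>k\<in>T. (cmod (ip ((frame_op T ^^ Suc e) x) (u k)))\<^sup>2)"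
      unfolding sq by (simp only: norm_sum_mult_cnj_le)
    also have "\<dots> = moment (Suc (2 * e)) T x * moment (Suc (2 * Suc e)) T x"
      by (simp only: moment_odd)
    finally show ?thesis by (simp add: n)
  qed
qed

lemma moment_0: "moment 0 T x = (\<Sum>j\<in>J. (cmod (x j))\<^sup>2)"
  using moment_even[of 0 T x] by simp

lemma frame_op_add_scale: "frame_op T (\<lambda>j. x j + c * z j) = (\<lambda>j. frame_op T x j + c * frame_op T z j)"
  by (simp add: frame_op_def ip_add_scale_left sum.distrib sum_distrib_left algebra_simps)

lemma frame_op_funpow_add_scale:
  "(frame_op T ^^ n) (\<lambda>j. x j + c * z j) = (\<lambda>j. (frame_op T ^^ n) x j + c * (frame_op T ^^ n) z j)"
  by (induction n) (simp_all add: frame_op_add_scale)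

text \<open>
This is the telescoping sum
\<open>A ^ n - B ^ n = (\<Sum>i<n. A ^ (n - 1 - i) * (A - B) * B ^ i)\<close> for the rank-one perturbation
\<open>A - B = u k (u k)\<^sup>*\<close>.
\<close>
lemma frame_op_insert_funpow:
  assumes "finite T" "k \<notin> T"
  shows "ip ((frame_op (insert k T) ^^ n) x) y = ip ((frame_op T ^^ n) x) y +
     (\<Sum>i<n. ip ((frame_op T ^^ i) x) (u k) * ip ((frame_op (insert k T) ^^ (n - Suc i)) (u k)) y)"
proof (induction n arbitrary: x)
  case (Suc n)
  have "frame_op (insert k T) x = (\<lambda>j. frame_op T x j + ip x (u k) * u k j)"
    using assms by (simp add: frame_op_def add.commute)
  then have "(frame_op (insert k T) ^^ Suc n) x = (\<lambda>j. (frame_op (insert k T) ^^ n) (frame_op T x) j +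
      ip x (u k) * (frame_op (insert k T) ^^ n) (u k) j)"
    by (simp add: funpow_Suc_right frame_op_funpow_add_scale del: funpow.simps)
  then show ?case
    by (simp add: ip_add_scale_left Suc.IH sum.lessThan_Suc_shift funpow_Suc_right
        del: funpow.simps sum.lessThan_Suc)
qed simp

lemma moment_insert:
  assumes "finite T" "k \<notin> T"
  shows "moment n (insert k T) (u k) = moment n T (u k) +
    (\<Sum>i<n. moment i (insert k T) (u k) * moment (n - Suc i) T (u k))"
proof -
  have "(of_real (moment n (insert k T) (u k)) :: complex) = of_real (moment n T (u k)) +
    (\<Sum>i<n. of_real (moment i T (u k)) * of_real (moment (n - Suc i) (insert k T) (u k)))"
    unfolding of_real_moment by (rule frame_op_insert_funpow[OF assms])
  then have "moment n (insert k T) (u k) = moment n T (u k) +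
    (\<Sum>i<n. moment i T (u k) * moment (n - Suc i) (insert k T) (u k))"
    by (simp flip: of_real_mult of_real_sum of_real_add)
  also have "(\<Sum>i<n. moment i T (u k) * moment (n - Suc i) (insert k T) (u k)) =
      (\<Sum>i<n. moment (n - Suc i) T (u k) * moment (n - Suc (n - Suc i)) (insert k T) (u k))"
    by (rule sum.nat_diff_reindex[symmetric])
  also have "\<dots> = (\<Sum>i<n. moment i (insert k T) (u k) * moment (n - Suc i) T (u k))"
    by (intro sum.cong) (auto simp: Suc_diff_Suc mult.commute)
  finally show ?thesis .
qed

text \<open>
The decoupling step: adding \<open>k\<close> to \<open>T\<close> is felt by the moments at \<open>u k\<close> only through powers of
\<open>R\<close>, and the right-hand side no longer refers to the enlarged set.
\<close>
lemma moment_insert_le: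
  assumes "finite T" "k \<notin> T" and "(\<Sum>j\<in>J. (cmod (u k j))\<^sup>2) \<le> R"
  shows "moment n (insert k T) (u k) \<le>
    (\<Sum>r\<le>n. real (n choose r) * R ^ r * moment (n - r) T (u k))"
  using assms
  by (intro renewal_binomial_bound moment_nonneg moment_log_convex moment_insert)
    (simp_all add: moment_0)

end

section \<open>Random subsets\<close>

lemma set_pmf_random_subset: "set_pmf (random_subset N p) \<subseteq> Pow {..<N}"
  by (auto simp: random_subset_def selected_def)

lemma finite_set_pmf_random_subset: "finite (set_pmf (random_subset N p))"
  using set_pmf_random_subset by (rule finite_subset) simp

lemma integrable_random_subset:
  fixes F :: "nat set \<Rightarrow> real"
  shows "integrable (measure_pmf (random_subset N p)) F"
  by (rule integrable_measure_pmf_finite) (rule finite_set_pmf_random_subset)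

lemma expectation_random_subset:
  fixes F :: "nat set \<Rightarrow> real"
  shows "measure_pmf.expectation (random_subset N p) F =
    (\<Sum>T\<in>Pow {..<N}. pmf (random_subset N p) T * F T)"
  using set_pmf_random_subset[of N p]
  by (subst integral_measure_pmf[where A = "Pow {..<N}"]) auto

lemma pmf_random_subset:
  assumes "p \<in> {0..1}" "T \<subseteq> {..<N}"
  shows "pmf (random_subset N p) T = p ^ card T * (1 - p) ^ (N - card T)"
proof -
  define I where "I = (\<lambda>j. j \<in> T)"
  let ?M = "bernoulli_seq N p"
  have fin: "finite T" using assms(2) by (rule finite_subset) simp
  have "pmf (random_subset N p) T = measure_pmf.prob ?M (selected N -` {T})"
    by (simp add: random_subset_def pmf_map)
  also have "\<dots> = measure_pmf.prob ?M {I}"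
  proof (rule measure_eq_AE)
    have "I' = I" if "I' \<in> set_pmf ?M" "selected N I' = T" for I'
    proof
      fix j show "I' j = I j"
        using that set_Pi_pmf_subset[of "{..<N}" False "\<lambda>_. bernoulli_pmf p"] assms(2)
        by (cases "j < N") (auto simp: I_def selected_def bernoulli_seq_def)
    qed
    moreover have "selected N I = T" using assms(2) by (auto simp: I_def selected_def)
    ultimately show "AE I' in ?M. (I' \<in> selected N -` {T}) = (I' \<in> {I})"
      by (auto simp: AE_measure_pmf_iff)
  qed auto
  also have "\<dots> = pmf ?M I" by (simp add: pmf.rep_eq)
  also have "\<dots> = (\<Prod>j<N. pmf (bernoulli_pmf p) (I j))"
    unfolding bernoulli_seq_def using assms(2) by (intro pmf_Pi') (auto simp: I_def)
  also have "\<dots> = (\<Prod>j<N. if j \<in> T then p else 1 - p)"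
    using assms(1) by (intro prod.cong) (auto simp: I_def)
  also have "\<dots> = p ^ card ({..<N} \<inter> T) * (1 - p) ^ card ({..<N} \<inter> - T)"
    by (simp add: prod.If_cases)
  also have "{..<N} \<inter> T = T" using assms(2) by auto
  also have "card ({..<N} \<inter> - T) = N - card T"
    using assms(2) fin by (simp add: card_Diff_subset flip: Diff_eq)
  finally show ?thesis .
qed

text \<open>
The probability of \<open>insert k T\<close> is \<open>p / (1 - p)\<close> times that of \<open>T\<close> when \<open>k \<notin> T\<close>. Through this
identity the independence of the selections enters the moment bound.
\<close>
lemma random_subset_exchange:
  fixes F :: "nat set \<Rightarrow> real"
  assumes p: "0 \<le> p" "p < 1" and k: "k < N"
  shows "measure_pmf.expectation (random_subset N p) (\<lambda>T. if k \<in> T then F T else 0) =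
    p / (1 - p) * measure_pmf.expectation (random_subset N p) (\<lambda>T. if k \<in> T then 0 else F (insert k T))"
proof -
  let ?w = "pmf (random_subset N p)"
  let ?P = "Pow {..<N}"
  have weight: "?w (insert k T) = p / (1 - p) * ?w T" if T: "T \<in> ?P" "k \<notin> T" for T
  proof -
    have fin: "finite T" using T(1) finite_subset by blast
    have "card (insert k T) \<le> card {..<N}" using T(1) k by (intro card_mono) auto
    then have le: "Suc (card T) \<le> N" using fin T by simp
    then have "(1 - p) ^ (N - card T) = (1 - p) ^ (N - Suc (card T)) * (1 - p)"
      by (simp add: Suc_diff_Suc flip: power_Suc2)
    then show ?thesis using T fin k p by (simp add: pmf_random_subset)
  qed
  have "measure_pmf.expectation (random_subset N p) (\<lambda>T. if k \<in> T then F T else 0) =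
      (\<Sum>T\<in>{T\<in>?P. k \<in> T}. ?w T * F T)"
    unfolding expectation_random_subset by (intro sum.mono_neutral_cong_right) auto
  also have "\<dots> = (\<Sum>T\<in>{T\<in>?P. k \<notin> T}. ?w (insert k T) * F (insert k T))"
    using k by (intro sum.reindex_bij_witness[of _ "insert k" "\<lambda>T. T - {k}"])
      (auto simp: insert_absorb)
  also have "\<dots> = p / (1 - p) * (\<Sum>T\<in>{T\<in>?P. k \<notin> T}. ?w T * F (insert k T))"
    unfolding sum_distrib_left by (intro sum.cong) (auto simp: weight)
  also have "(\<Sum>T\<in>{T\<in>?P. k \<notin> T}. ?w T * F (insert k T)) =
      (\<Sum>T\<in>?P. ?w T * (if k \<in> T then 0 else F (insert k T)))"
    by (intro sum.mono_neutral_cong_left) auto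
  finally show ?thesis unfolding expectation_random_subset .
qed

lemma map_card_random_subset:
  assumes "p \<in> {0..1}"
  shows "map_pmf card (random_subset N p) = binomial_pmf N p"
  using assms
  by (simp add: random_subset_def bernoulli_seq_def map_pmf_comp selected_def
      binomial_pmf_altdef'[where A = "{..<N}" and dflt = False])

lemma expected_size_random_subset:
  assumes "p \<in> {0..1}"
  shows "expected_size (random_subset N p) = real N * p"
proof -
  have "expected_size (random_subset N p) = measure_pmf.expectation (binomial_pmf N p) real"
    by (simp add: expected_size_def flip: map_card_random_subset[OF assms])
  also have "\<dots> = (\<Sum>n\<le>N. real n * Bernstein N n p)"
    using assms by (simp add: expectation_binomial_pmf' Bernstein_def mult_ac)
  also have "\<dots> = real N * p" by (rule sum_k_Bernstein)
  finally show ?thesis .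
qed

text \<open>
Markov's inequality for \<open>2 ^ card T\<close>, whose expectation is \<open>(1 + p) ^ N \<le> exp (N * p)\<close>; the factor
\<open>3\<close> is enough because \<open>exp 2 \<le> 2 ^ 3\<close>.
\<close>
lemma prob_card_random_subset_ge:
  assumes p: "p \<in> {0..1}"
  shows "measure_pmf.prob (random_subset N p) {T. 3 * (real N * p) \<le> real (card T)} \<le> exp (- (real N * p))"
proof -
  let ?G = "random_subset N p"
  have "measure_pmf.expectation ?G (\<lambda>T. (2::real) ^ card T) = measure_pmf.expectation (binomial_pmf N p) (\<lambda>n. (2::real) ^ n)"
    by (simp flip: map_card_random_subset[OF p])
  also have "\<dots> = (\<Sum>n\<le>N. real (N choose n) * p ^ n * (1 - p) ^ (N - n) * 2 ^ n)"
    using p by (intro expectation_binomial_pmf'[THEN trans]) (auto intro!: sum.cong simp: mult_ac)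
  also have "\<dots> = (\<Sum>n\<le>N. real (N choose n) * (2 * p) ^ n * (1 - p) ^ (N - n))"
    by (simp add: power_mult_distrib ac_simps)
  also have "\<dots> = (2 * p + (1 - p)) ^ N" by (rule binomial_ring[symmetric])
  also have "\<dots> = (1 + p) ^ N" by (simp add: add.commute)
  also have "\<dots> \<le> exp p ^ N" using p by (intro power_mono) auto
  also have "\<dots> = exp (real N * p)" by (simp add: exp_of_nat_mult)
  finally have mgf: "measure_pmf.expectation ?G (\<lambda>T. 2 ^ card T) \<le> exp (real N * p)" .
  have e_sq: "exp 2 \<le> (8::real)"
  proof -
    have "exp 2 = exp 1 * exp (1::real)" by (simp flip: exp_add)
    also have "\<dots> \<le> (272/100) * (272/100)" using e_less_272 by (intro mult_mono) auto
    finally show ?thesis by simp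
  qed
  have event: "{T. 3 * (real N * p) \<le> real (card T)} = {T. 2 powr (3 * (real N * p)) \<le> 2 ^ card T}"
    by (auto simp: powr_realpow[symmetric])
  have "measure_pmf.prob ?G {T. 3 * (real N * p) \<le> real (card T)} \<le>
      measure_pmf.expectation ?G (\<lambda>T. 2 ^ card T) / 2 powr (3 * (real N * p))"
    unfolding event using integral_Markov_inequality_measure[where M = "measure_pmf ?G" and A = "{}" and
        u = "\<lambda>T. 2 ^ card T" and c = "2 powr (3 * (real N * p))"]
    by (simp add: integrable_random_subset)
  also have "\<dots> \<le> exp (real N * p) / 2 powr (3 * (real N * p))"
    using mgf by (rule divide_right_mono) simp
  also have "2 powr (3 * (real N * p)) = 8 powr (real N * p)"
    by (simp flip: powr_powr)
  also have "exp (real N * p) / 8 powr (real N * p) \<le> exp (real N * p) / exp 2 powr (real N * p)"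
    using e_sq p by (intro divide_left_mono powr_mono2) auto
  also have "\<dots> = exp (- (real N * p))"
    by (simp add: powr_def flip: exp_diff)
  finally show ?thesis .
qed

section \<open>Traces of powers of a random frame operator\<close>

text \<open>
The second assumption says \<open>frame_op {..<N}\<close> is the identity on functions on \<open>J\<close>. It holds for the
restriction to \<open>J\<close> of the rows of a unitary matrix.
\<close>
locale tight_frame = vector_family J u for J :: "'j set" and u :: "nat \<Rightarrow> 'j \<Rightarrow> complex" +
  fixes N :: nat
  assumes finite_J: "finite J"
    and resolution_of_identity:
      "\<And>i j. i \<in> J \<Longrightarrow> j \<in> J \<Longrightarrow> (\<Sum>k<N. u k i * cnj (u k j)) = (if i = j then 1 else 0)"
begin

lemma parseval: "(\<Sum>k<N. ip x (u k) * cnj (ip y (u k))) = ip x y"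
proof -
  have "frame_op {..<N} x i = x i" if i: "i \<in> J" for i
  proof -
    have "frame_op {..<N} x i = (\<Sum>k<N. \<Sum>j\<in>J. x j * (u k i * cnj (u k j)))"
      by (simp add: frame_op_def ip_def sum_distrib_left mult_ac)
    also have "\<dots> = (\<Sum>j\<in>J. x j * (\<Sum>k<N. u k i * cnj (u k j)))"
      by (subst sum.swap) (simp add: sum_distrib_left)
    also have "\<dots> = (\<Sum>j\<in>J. if i = j then x j else 0)"
      using i by (intro sum.cong) (auto simp: resolution_of_identity)
    also have "\<dots> = x i" using i finite_J by simp
    finally show ?thesis .
  qed
  then have "ip (frame_op {..<N} x) y = ip x y" by (simp add: ip_def)
  then show ?thesis by (simp add: ip_frame_op)
qed

text \<open>
In a tight frame \<open>(\<Sum>k<N. \<langle>A (u k), u k\<rangle>)\<close> is the trace of \<open>A\<close>, so this is the trace of the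
\<open>n\<close>-th power of \<open>frame_op T\<close>.
\<close>
definition power_trace :: "nat \<Rightarrow> nat set \<Rightarrow> real" where
  "power_trace n T = (\<Sum>k<N. moment n T (u k))"

lemma power_trace_nonneg: "0 \<le> power_trace n T"
  by (simp add: power_trace_def sum_nonneg moment_nonneg)

lemma power_trace_0: "power_trace 0 T = real (card J)"
proof -
  have "complex_of_real (power_trace 0 T) = (\<Sum>k<N. \<Sum>j\<in>J. u k j * cnj (u k j))"
    by (simp add: power_trace_def of_real_moment ip_def)
  also have "\<dots> = (\<Sum>j\<in>J. \<Sum>k<N. u k j * cnj (u k j))" by (rule sum.swap)
  also have "\<dots> = of_real (real (card J))" by (simp add: resolution_of_identity)
  finally show ?thesis by (simp only: of_real_eq_iff)
qed

text \<open>
Both sides are the trace of \<open>S * S ^ n\<close>. On the left it is computed in the full frame, on the right by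
writing out the leading factor \<open>S\<close>. Trading a sum over all \<open>k < N\<close> for a sum over \<open>T\<close> is what
closes the recursion for the expected traces.
\<close>
lemma power_trace_Suc: "power_trace (Suc n) T = (\<Sum>k\<in>T. moment n T (u k))"
proof -
  have "complex_of_real (power_trace (Suc n) T) =
      (\<Sum>k<N. \<Sum>i\<in>T. ip ((frame_op T ^^ n) (u k)) (u i) * cnj (ip (u k) (u i)))"
    by (simp add: power_trace_def of_real_moment ip_frame_op)
  also have "\<dots> = (\<Sum>i\<in>T. \<Sum>k<N. ip ((frame_op T ^^ n) (u k)) (u i) * cnj (ip (u k) (u i)))"
    by (rule sum.swap)
  also have "\<dots> = (\<Sum>i\<in>T. \<Sum>k<N. ip (u i) (u k) * cnj (ip ((frame_op T ^^ n) (u i)) (u k)))"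
    by (simp add: cnj_ip frame_op_funpow_self_adjoint mult.commute)
  also have "\<dots> = (\<Sum>i\<in>T. ip (u i) ((frame_op T ^^ n) (u i)))"
    by (simp only: parseval)
  also have "\<dots> = of_real (\<Sum>i\<in>T. moment n T (u i))"
    by (simp add: of_real_moment frame_op_funpow_self_adjoint)
  finally show ?thesis by (simp only: of_real_eq_iff)
qed

text \<open>
A vector on which \<open>S\<close> has Rayleigh quotient \<open>\<theta>\<close> forces \<open>\<langle>S ^ L f, f\<rangle> \<ge> \<theta> ^ L * \<langle>f, f\<rangle>\<close> by log-convexity,
and the left-hand side is at most \<open>\<langle>f, f\<rangle>\<close> times the trace of \<open>S ^ L\<close>. For odd \<open>L = 2 * e + 1\<close> the last
bound is the Cauchy-Schwarz inequality applied to each \<open>\<langle>f, S ^ e (u k)\<rangle>\<close>.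
\<close>
lemma power_trace_ge:
  assumes "0 < (\<Sum>j\<in>J. (cmod (f j))\<^sup>2)" and "0 \<le> \<theta>" and "odd L"
    and large: "\<theta> * (\<Sum>j\<in>J. (cmod (f j))\<^sup>2) \<le> (\<Sum>k\<in>T. (cmod (ip f (u k)))\<^sup>2)"
  shows "\<theta> ^ L \<le> power_trace L T"
proof -
  let ?f2 = "\<Sum>j\<in>J. (cmod (f j))\<^sup>2"
  obtain e where L: "L = Suc (2 * e)" using \<open>odd L\<close> by (metis oddE Suc_eq_plus1)
  have "\<theta> ^ L * moment 0 T f \<le> moment L T f"
    using assms moment_odd[of 0 T f] moment_nonneg moment_log_convex
    by (intro log_convex_geometric[where y = "\<lambda>n. moment n T f"]) (simp_all add: moment_0)
  also have "moment L T f = (\<Sum>k\<in>T. (cmod (ip f ((frame_op T ^^ e) (u k))))\<^sup>2)"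
    by (simp only: L moment_odd frame_op_funpow_self_adjoint)
  also have "\<dots> \<le> (\<Sum>k\<in>T. ?f2 * moment (2 * e) T (u k))"
    unfolding moment_even ip_def by (intro sum_mono norm_sum_mult_cnj_le)
  also have "\<dots> = ?f2 * power_trace L T"
    by (simp add: L power_trace_Suc sum_distrib_left)
  finally have "?f2 * \<theta> ^ L \<le> ?f2 * power_trace L T" by (simp add: moment_0 mult.commute)
  then show ?thesis using assms(1) by (simp only: mult_le_cancel_left_pos)
qed

text \<open>
In \<open>(\<Sum>k\<in>T. moment n T (u k))\<close> the summand at \<open>k\<close> sees the set \<open>T\<close> only when it contains \<open>k\<close>. The exchange
identity removes \<open>k\<close> at the price of the factor \<open>p / (1 - p)\<close>, the decoupling step expresses the
moment by lower moments without \<open>k\<close>, and these sum up to traces again. The recursion is that of the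
moments of \<open>R\<close> times a Poisson variable.
\<close>
lemma expectation_power_trace_Suc_le:
  assumes p: "0 \<le> p" "p < 1" and R: "\<And>k. k < N \<Longrightarrow> (\<Sum>j\<in>J. (cmod (u k j))\<^sup>2) \<le> R" "0 \<le> R"
  shows "measure_pmf.expectation (random_subset N p) (power_trace (Suc n)) \<le>
    p / (1 - p) * (\<Sum>r\<le>n. real (n choose r) * R ^ r *
      measure_pmf.expectation (random_subset N p) (power_trace (n - r)))"
proof -
  let ?G = "random_subset N p"
  let ?E = "measure_pmf.expectation ?G"
  let ?b = "\<lambda>k T. \<Sum>r\<le>n. real (n choose r) * R ^ r * moment (n - r) T (u k)"
  have "?E (power_trace (Suc n)) = ?E (\<lambda>T. \<Sum>k<N. if k \<in> T then moment n T (u k) else 0)"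
    using set_pmf_random_subset[of N p]
    by (intro integral_cong_AE)
      (auto simp: AE_measure_pmf_iff power_trace_Suc Int_absorb1 simp flip: sum.inter_restrict)
  also have "\<dots> = (\<Sum>k<N. ?E (\<lambda>T. if k \<in> T then moment n T (u k) else 0))"
    by (rule Bochner_Integration.integral_sum) (rule integrable_random_subset)
  also have "\<dots> = (\<Sum>k<N. p / (1 - p) * ?E (\<lambda>T. if k \<in> T then 0 else moment n (insert k T) (u k)))"
    using p by (intro sum.cong) (auto simp: random_subset_exchange)
  also have "\<dots> \<le> (\<Sum>k<N. p / (1 - p) * ?E (?b k))"
  proof (intro sum_mono mult_left_mono integral_mono_AE integrable_random_subset)
    fix k assume "k \<in> {..<N}"
    then show "AE T in ?G. (if k \<in> T then 0 else moment n (insert k T) (u k)) \<le> ?b k T"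
      \<comment> \<open>On the event \<open>k \<in> T\<close> the left-hand side is the default value \<open>0\<close>, whence the nonnegativity facts.\<close>
      using R set_pmf_random_subset[of N p]
      by (auto simp: AE_measure_pmf_iff moment_nonneg intro!: sum_nonneg moment_insert_le
          dest: finite_subset)
  qed (use p in auto)
  also have "\<dots> = p / (1 - p) * ?E (\<lambda>T. \<Sum>k<N. ?b k T)"
    by (simp add: integrable_random_subset sum_distrib_left)
  also have "(\<lambda>T. \<Sum>k<N. ?b k T) = (\<lambda>T. \<Sum>r\<le>n. real (n choose r) * R ^ r * power_trace (n - r) T)"
    unfolding power_trace_def sum_distrib_left by (subst sum.swap) (rule refl)
  also have "?E \<dots> = (\<Sum>r\<le>n. real (n choose r) * R ^ r * ?E (power_trace (n - r)))"
    by (simp add: integrable_random_subset)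
  finally show ?thesis .
qed

text \<open>
By the binomial theorem a bound of the form \<open>card J * K ^ n\<close> reproduces itself under the recursion as
long as \<open>p / (1 - p) * (R + K) ^ m \<le> K ^ (m + 1)\<close>, which for small \<open>p\<close> and \<open>R\<close> holds up to a
large power \<open>m\<close> only.
\<close>
lemma expectation_power_trace_le:
  assumes p: "0 \<le> p" "p < 1" and R: "\<And>k. k < N \<Longrightarrow> (\<Sum>j\<in>J. (cmod (u k j))\<^sup>2) \<le> R" "0 \<le> R"
    and K: "0 \<le> K" "\<And>m. m < L \<Longrightarrow> p / (1 - p) * (R + K) ^ m \<le> K ^ Suc m"
  shows "n \<le> L \<Longrightarrow> measure_pmf.expectation (random_subset N p) (power_trace n) \<le> real (card J) * K ^ n"
proof (induction n rule: less_induct)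
  case (less n)
  let ?E = "measure_pmf.expectation (random_subset N p)"
  show ?case
  proof (cases n)
    case 0
    then show ?thesis by (simp add: power_trace_0)
  next
    case (Suc m)
    have "?E (power_trace n) \<le> p / (1 - p) * (\<Sum>r\<le>m. real (m choose r) * R ^ r * ?E (power_trace (m - r)))"
      unfolding Suc by (rule expectation_power_trace_Suc_le[OF p R])
    also have "\<dots> \<le> p / (1 - p) * (\<Sum>r\<le>m. real (m choose r) * R ^ r * (real (card J) * K ^ (m - r)))"
      using p R(2) less Suc by (intro mult_left_mono sum_mono) auto
    also have "\<dots> = real (card J) * (p / (1 - p) * (R + K) ^ m)"
      unfolding binomial_ring sum_distrib_left by (simp add: ac_simps)
    also have "\<dots> \<le> real (card J) * K ^ n"
      using K(2)[of m] less.prems Suc by (intro mult_left_mono) auto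
    finally show ?thesis .
  qed
qed

lemma prob_concentrated_le:
  assumes p: "0 \<le> p" "p < 1" and R: "\<And>k. k < N \<Longrightarrow> (\<Sum>j\<in>J. (cmod (u k j))\<^sup>2) \<le> R" "0 \<le> R"
    and K: "0 \<le> K" "\<And>m. m < L \<Longrightarrow> p / (1 - p) * (R + K) ^ m \<le> K ^ Suc m"
    and "odd L" "0 < \<theta>"
  shows "measure_pmf.prob (random_subset N p)
    {T. \<exists>f. \<theta> * (\<Sum>j\<in>J. (cmod (f j))\<^sup>2) < (\<Sum>k\<in>T. (cmod (ip f (u k)))\<^sup>2)} \<le>
    real (card J) * (K / \<theta>) ^ L" (is "measure_pmf.prob ?G ?bad \<le> _")
proof -
  have "\<theta> ^ L \<le> power_trace L T" if bad: "T \<in> ?bad" for T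
  proof -
    obtain f where f: "\<theta> * (\<Sum>j\<in>J. (cmod (f j))\<^sup>2) < (\<Sum>k\<in>T. (cmod (ip f (u k)))\<^sup>2)"
      using bad by blast
    have "(\<Sum>j\<in>J. (cmod (f j))\<^sup>2) \<noteq> 0"
    proof
      assume "(\<Sum>j\<in>J. (cmod (f j))\<^sup>2) = 0"
      then have "f j = 0" if "j \<in> J" for j
        using that finite_J by (simp add: sum_nonneg_eq_0_iff)
      then have "ip f (u k) = 0" for k by (simp add: ip_def)
      then show False using f \<open>(\<Sum>j\<in>J. (cmod (f j))\<^sup>2) = 0\<close> by simp
    qed
    then have "0 < (\<Sum>j\<in>J. (cmod (f j))\<^sup>2)"
      using sum_nonneg[of J "\<lambda>j. (cmod (f j))\<^sup>2"] by simp
    then show ?thesis using f \<open>odd L\<close> \<open>0 < \<theta>\<close> by (intro power_trace_ge[of f]) auto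
  qed
  then have "measure_pmf.prob ?G ?bad \<le> measure_pmf.prob ?G {T. \<theta> ^ L \<le> power_trace L T}"
    by (intro measure_pmf.finite_measure_mono) auto
  also have "\<dots> \<le> measure_pmf.expectation ?G (power_trace L) / \<theta> ^ L"
    using integral_Markov_inequality_measure[where M = "measure_pmf ?G" and A = "{}" and
        u = "power_trace L" and c = "\<theta> ^ L"] \<open>0 < \<theta>\<close>
    by (simp add: integrable_random_subset power_trace_nonneg)
  also have "\<dots> \<le> real (card J) * K ^ L / \<theta> ^ L"
    using expectation_power_trace_le[OF p R K, of L L] \<open>0 < \<theta>\<close> by (intro divide_right_mono) auto
  finally show ?thesis by (simp add: power_divide)
qed

end

section \<open>Pairs of orthonormal bases\<close>

lemma orthonormal_basis_carrier:
  assumes "orthonormal_basis N \<Phi>" "k < N"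
  shows "\<Phi> k \<in> carrier_vec N"
proof -
  interpret V: vec_space "TYPE(complex)" N .
  show ?thesis using assms unfolding orthonormal_basis_def V.basis_def by auto
qed

lemma cnj_cscalar_prod:
  assumes "x \<in> carrier_vec N" "y \<in> carrier_vec N"
  shows "cnj (x \<bullet>c y) = y \<bullet>c x"
  using assms by (simp add: scalar_prod_def mult.commute)

text \<open>
Inserting the expansion of \<open>x\<close> in the basis gives Parseval's identity in polarized form; the norm identity
and the tight frame property below are instances of it.
\<close>
lemma cscalar_prod_expansion:
  assumes \<Phi>: "orthonormal_basis N \<Phi>" and x: "x \<in> carrier_vec N" and y: "y \<in> carrier_vec N"
  shows "x \<bullet>c y = (\<Sum>k<N. (x \<bullet>c \<Phi> k) * (\<Phi> k \<bullet>c y))"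
proof -
  have "x \<bullet>c y = (\<Sum>i<N. x $ i * cnj (y $ i))"
    using y by (simp add: scalar_prod_def lessThan_atLeast0)
  also have "\<dots> = (\<Sum>i<N. \<Sum>k<N. (x \<bullet>c \<Phi> k) * (\<Phi> k $ i * cnj (y $ i)))"
    using coeffs_in_expansion[OF \<Phi> x]
    by (intro sum.cong) (simp_all add: coeffs_in_def sum_distrib_right mult.assoc)
  also have "\<dots> = (\<Sum>k<N. (x \<bullet>c \<Phi> k) * (\<Sum>i<N. \<Phi> k $ i * cnj (y $ i)))"
    by (subst sum.swap) (simp add: sum_distrib_left)
  also have "\<dots> = (\<Sum>k<N. (x \<bullet>c \<Phi> k) * (\<Phi> k \<bullet>c y))"
    using y by (simp add: scalar_prod_def lessThan_atLeast0)
  finally show ?thesis .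
qed

lemma vec_l2norm_sq: "(vec_l2norm v)\<^sup>2 = (\<Sum>k<dim_vec v. (cmod (v $ k))\<^sup>2)"
  by (simp add: vec_l2norm_def L2_set_def sum_nonneg)

lemma vec_l2norm_sq_coeffs_in:
  assumes \<Phi>: "orthonormal_basis N \<Phi>" and f: "f \<in> carrier_vec N"
  shows "(vec_l2norm f)\<^sup>2 = (\<Sum>k<N. (cmod (f \<bullet>c \<Phi> k))\<^sup>2)"
proof -
  have "complex_of_real ((vec_l2norm f)\<^sup>2) = f \<bullet>c f"
    using f by (simp add: vec_l2norm_sq scalar_prod_def lessThan_atLeast0 complex_norm_square del: of_real_power)
  also have "\<dots> = (\<Sum>k<N. (f \<bullet>c \<Phi> k) * cnj (f \<bullet>c \<Phi> k))"
    unfolding cscalar_prod_expansion[OF \<Phi> f f]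
    by (intro sum.cong) (simp_all add: cnj_cscalar_prod[OF f orthonormal_basis_carrier[OF \<Phi>]])
  also have "\<dots> = complex_of_real (\<Sum>k<N. (cmod (f \<bullet>c \<Phi> k))\<^sup>2)"
    by (simp flip: complex_norm_square)
  finally show ?thesis by (simp only: of_real_eq_iff)
qed

lemma vec_l2norm_sq_restrict_to:
  assumes "dim_vec v = N" "T \<subseteq> {..<N}"
  shows "(vec_l2norm (restrict_to T v))\<^sup>2 = (\<Sum>k\<in>T. (cmod (v $ k))\<^sup>2)"
proof -
  have "(vec_l2norm (restrict_to T v))\<^sup>2 = (\<Sum>k<N. (cmod (v $ k * indicator T k))\<^sup>2)"
    using assms(1) by (simp add: vec_l2norm_sq restrict_to_def)
  also have "\<dots> = (\<Sum>k\<in>T. (cmod (v $ k))\<^sup>2)"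
    using assms(2) by (intro sum.mono_neutral_cong_right) auto
  finally show ?thesis .
qed

text \<open>
The vectors are the rows, cut down to \<open>J\<close>, of the unitary matrix of the change of basis; its columns
are orthonormal.
\<close>
lemma tight_frame_of_bases:
  assumes \<Phi>: "orthonormal_basis N \<Phi>" and \<Psi>: "orthonormal_basis N \<Psi>" and J: "J \<subseteq> {..<N}"
  shows "tight_frame J (\<lambda>k j. \<Psi> k \<bullet>c \<Phi> j) N"
proof
  show "finite J" using J by (rule finite_subset) simp
  fix i j assume "i \<in> J" "j \<in> J"
  then have ij: "i < N" "j < N" using J by auto
  have "(\<Sum>k<N. (\<Psi> k \<bullet>c \<Phi> i) * cnj (\<Psi> k \<bullet>c \<Phi> j)) = (\<Sum>k<N. (\<Phi> j \<bullet>c \<Psi> k) * (\<Psi> k \<bullet>c \<Phi> i))"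
    using ij by (intro sum.cong)
      (simp_all add: cnj_cscalar_prod[OF orthonormal_basis_carrier[OF \<Psi>] orthonormal_basis_carrier[OF \<Phi>]] mult.commute)
  also have "\<dots> = \<Phi> j \<bullet>c \<Phi> i"
    by (rule cscalar_prod_expansion[OF \<Psi>, symmetric]) (use ij \<Phi> in \<open>auto intro: orthonormal_basis_carrier\<close>)
  also have "\<dots> = (if i = j then 1 else 0)"
    using ij \<Phi> unfolding orthonormal_basis_def by auto
  finally show "(\<Sum>k<N. (\<Psi> k \<bullet>c \<Phi> i) * cnj (\<Psi> k \<bullet>c \<Phi> j)) = (if i = j then 1 else 0)" .
qed

text \<open>
For a signal whose coefficients in the first basis live on \<open>J\<close>, the coefficients in the second basis are inner products with the
frame vectors, so the energy that they have on \<open>T\<close> is the quadratic form of \<open>frame_op T\<close>.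
\<close>
lemma coeffs_of_supported:
  assumes \<Phi>: "orthonormal_basis N \<Phi>" and \<Psi>: "orthonormal_basis N \<Psi>" and J: "J \<subseteq> {..<N}"
    and f: "f \<in> carrier_vec N" "vec_supported_on (coeffs_in N \<Phi> f) J" and k: "k < N"
  shows "vector_family.ip J (\<lambda>j. f \<bullet>c \<Phi> j) (\<lambda>j. \<Psi> k \<bullet>c \<Phi> j) = coeffs_in N \<Psi> f $ k"
proof -
  have "coeffs_in N \<Psi> f $ k = (\<Sum>j<N. (f \<bullet>c \<Phi> j) * (\<Phi> j \<bullet>c \<Psi> k))"
    using k f(1) by (simp add: coeffs_in_def cscalar_prod_expansion[OF \<Phi>] orthonormal_basis_carrier[OF \<Psi>])
  also have "\<dots> = (\<Sum>j\<in>J. (f \<bullet>c \<Phi> j) * (\<Phi> j \<bullet>c \<Psi> k))"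
    using f(2) J by (intro sum.mono_neutral_right) (auto simp: vec_supported_on_def coeffs_in_def)
  also have "\<dots> = (\<Sum>j\<in>J. (f \<bullet>c \<Phi> j) * cnj (\<Psi> k \<bullet>c \<Phi> j))"
    using J k by (intro sum.cong refl)
      (subst cnj_cscalar_prod[OF orthonormal_basis_carrier[OF \<Psi>] orthonormal_basis_carrier[OF \<Phi>]], auto)
  finally show ?thesis by (simp add: vector_family.ip_def)
qed

lemma cmod_le_mutual_incoherence:
  assumes "i < N" "j < N"
  shows "cmod (\<Phi> i \<bullet>c \<Psi> j) \<le> mutual_incoherence N \<Phi> \<Psi>"
proof -
  have eq: "{cmod (\<phi> \<bullet>c \<psi>) | \<phi> \<psi>. \<phi> \<in> \<Phi> ` {..<N} \<and> \<psi> \<in> \<Psi> ` {..<N}} =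
      (\<lambda>(i, j). cmod (\<Phi> i \<bullet>c \<Psi> j)) ` ({..<N} \<times> {..<N})"
    by auto
  show ?thesis
    unfolding mutual_incoherence_def eq using assms by (intro Max_ge) (auto intro!: image_eqI[where x = "(i, j)"])
qed

lemma mutual_incoherence_commute:
  assumes "orthonormal_basis N \<Phi>" "orthonormal_basis N \<Psi>"
  shows "mutual_incoherence N \<Phi> \<Psi> = mutual_incoherence N \<Psi> \<Phi>"
proof -
  have "cmod (\<Phi> i \<bullet>c \<Psi> j) = cmod (\<Psi> j \<bullet>c \<Phi> i)" if "i < N" "j < N" for i j
    using cnj_cscalar_prod[OF orthonormal_basis_carrier[OF assms(1) that(1)]
        orthonormal_basis_carrier[OF assms(2) that(2)]]
    by (metis complex_mod_cnj)
  then have "{cmod (\<phi> \<bullet>c \<psi>) | \<phi> \<psi>. \<phi> \<in> \<Phi> ` {..<N} \<and> \<psi> \<in> \<Psi> ` {..<N}} =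
    {cmod (\<psi> \<bullet>c \<phi>) | \<psi> \<phi>. \<psi> \<in> \<Psi> ` {..<N} \<and> \<phi> \<in> \<Phi> ` {..<N}}"
    by auto (metis imageI lessThan_iff)+
  then show ?thesis unfolding mutual_incoherence_def by simp
qed

text \<open>
A unit vector has \<open>N\<close> coefficients of modulus at most the incoherence, and their squares sum to \<open>1\<close>.
\<close>
lemma mutual_incoherence_ge:
  assumes \<Phi>: "orthonormal_basis N \<Phi>" and \<Psi>: "orthonormal_basis N \<Psi>" and N: "0 < N"
  shows "1 \<le> real N * (mutual_incoherence N \<Phi> \<Psi>)\<^sup>2"
proof -
  have c: "\<Phi> 0 \<in> carrier_vec N" using \<Phi> N by (rule orthonormal_basis_carrier)
  have "\<Phi> 0 \<bullet>c \<Phi> k = (if k = 0 then 1 else 0)" if "k < N" for k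
    using \<Phi> N that unfolding orthonormal_basis_def by auto
  then have "(vec_l2norm (\<Phi> 0))\<^sup>2 = (\<Sum>k<N. if k = 0 then 1 else 0)"
    unfolding vec_l2norm_sq_coeffs_in[OF \<Phi> c] by (intro sum.cong) auto
  then have "1 = (vec_l2norm (\<Phi> 0))\<^sup>2" using N by simp
  also have "\<dots> = (\<Sum>k<N. (cmod (\<Phi> 0 \<bullet>c \<Psi> k))\<^sup>2)" by (rule vec_l2norm_sq_coeffs_in[OF \<Psi> c])
  also have "\<dots> \<le> (\<Sum>k<N. (mutual_incoherence N \<Phi> \<Psi>)\<^sup>2)"
    using N by (intro sum_mono power_mono cmod_le_mutual_incoherence) auto
  finally show ?thesis by simp
qed

section \<open>Concentration of signals\<close>

definition concentrated_on :: "nat \<Rightarrow> (nat \<Rightarrow> complex vec) \<Rightarrow> (nat \<Rightarrow> complex vec) \<Rightarrow> nat set \<Rightarrow> nat set \<Rightarrow> bool" where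
  "concentrated_on N \<Phi> \<Psi> J T \<longleftrightarrow> (\<exists>f \<in> carrier_vec N. vec_supported_on (coeffs_in N \<Phi> f) J \<and>
     (vec_l2norm f)\<^sup>2 / 2 < (vec_l2norm (restrict_to T (coeffs_in N \<Psi> f)))\<^sup>2)"

lemma prob_concentrated_on_le:
  assumes \<Phi>: "orthonormal_basis N \<Phi>" and \<Psi>: "orthonormal_basis N \<Psi>" and J: "J \<subseteq> {..<N}"
    and p: "0 \<le> p" "p < 1" and "odd L" and "0 \<le> K"
    and K: "\<And>m. m < L \<Longrightarrow>
      p / (1 - p) * (real (card J) * (mutual_incoherence N \<Phi> \<Psi>)\<^sup>2 + K) ^ m \<le> K ^ Suc m"
  shows "measure_pmf.prob (random_subset N p) {T. concentrated_on N \<Phi> \<Psi> J T} \<le> real N * (2 * K) ^ L"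
proof -
  let ?\<mu> = "mutual_incoherence N \<Phi> \<Psi>"
  let ?u = "\<lambda>k j. \<Psi> k \<bullet>c \<Phi> j"
  let ?G = "random_subset N p"
  interpret tight_frame J ?u N using \<Phi> \<Psi> J by (rule tight_frame_of_bases)
  let ?bad = "{T. \<exists>c. 1 / 2 * (\<Sum>j\<in>J. (cmod (c j))\<^sup>2) < (\<Sum>k\<in>T. (cmod (ip c (?u k)))\<^sup>2)}"
  have "measure_pmf.prob ?G {T. concentrated_on N \<Phi> \<Psi> J T} \<le> measure_pmf.prob ?G ?bad"
  proof (intro measure_pmf.finite_measure_mono_AE)
    show "AE T in ?G. T \<in> {T. concentrated_on N \<Phi> \<Psi> J T} \<longrightarrow> T \<in> ?bad"
    proof (unfold AE_measure_pmf_iff, intro ballI impI)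
      fix T assume "T \<in> set_pmf ?G" and conc: "T \<in> {T. concentrated_on N \<Phi> \<Psi> J T}"
      then have T: "T \<subseteq> {..<N}" using set_pmf_random_subset[of N p] by auto
      obtain f where f: "f \<in> carrier_vec N" "vec_supported_on (coeffs_in N \<Phi> f) J"
        and large: "(vec_l2norm f)\<^sup>2 / 2 < (vec_l2norm (restrict_to T (coeffs_in N \<Psi> f)))\<^sup>2"
        using conc by (auto simp: concentrated_on_def)
      let ?c = "\<lambda>j. f \<bullet>c \<Phi> j"
      have "(vec_l2norm f)\<^sup>2 = (\<Sum>j<N. (cmod (?c j))\<^sup>2)"
        by (rule vec_l2norm_sq_coeffs_in[OF \<Phi> f(1)])
      also have "\<dots> = (\<Sum>j\<in>J. (cmod (?c j))\<^sup>2)"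
        using f(2) J by (intro sum.mono_neutral_right) (auto simp: vec_supported_on_def coeffs_in_def)
      finally have norm: "(vec_l2norm f)\<^sup>2 = (\<Sum>j\<in>J. (cmod (?c j))\<^sup>2)" .
      have "(vec_l2norm (restrict_to T (coeffs_in N \<Psi> f)))\<^sup>2 = (\<Sum>k\<in>T. (cmod (coeffs_in N \<Psi> f $ k))\<^sup>2)"
        using T by (intro vec_l2norm_sq_restrict_to) (auto simp: coeffs_in_def)
      also have "\<dots> = (\<Sum>k\<in>T. (cmod (ip ?c (?u k)))\<^sup>2)"
        using T by (intro sum.cong) (auto simp: coeffs_of_supported[OF \<Phi> \<Psi> J f])
      finally show "T \<in> ?bad" using large norm by auto
    qed
  qed auto
  also have "\<dots> \<le> real (card J) * (K / (1 / 2)) ^ L"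
  proof (rule prob_concentrated_le[OF p])
    fix k assume k: "k < N"
    have "(\<Sum>j\<in>J. (cmod (?u k j))\<^sup>2) \<le> (\<Sum>j\<in>J. ?\<mu>\<^sup>2)"
      using k J unfolding mutual_incoherence_commute[OF \<Phi> \<Psi>]
      by (intro sum_mono power_mono cmod_le_mutual_incoherence) auto
    then show "(\<Sum>j\<in>J. (cmod (?u k j))\<^sup>2) \<le> real (card J) * ?\<mu>\<^sup>2" by simp
  qed (use K \<open>0 \<le> K\<close> \<open>odd L\<close> in auto)
  also have "\<dots> \<le> real N * (2 * K) ^ L"
    using card_mono[OF _ J] \<open>0 \<le> K\<close> by (intro mult_mono) (auto simp: mult.commute)
  finally show ?thesis .
qed

lemma prob_pair_pmf_le:
  assumes "\<And>a. a \<in> set_pmf A \<Longrightarrow> P a \<Longrightarrow> measure_pmf.prob B {b. Q a b} \<le> c" and "0 \<le> c"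
  shows "measure_pmf.prob (pair_pmf A B) {(a, b). Q a b} \<le> measure_pmf.prob A {a. \<not> P a} + c"
proof -
  have "emeasure (pair_pmf A B) {(a, b). Q a b} =
      (\<integral>\<^sup>+a. \<integral>\<^sup>+b. indicator {(a, b). Q a b} (a, b) \<partial>B \<partial>A)"
    by (simp flip: nn_integral_pair_pmf')
  also have "\<dots> = (\<integral>\<^sup>+a. emeasure B {b. Q a b} \<partial>A)"
    by (simp add: indicator_def flip: nn_integral_indicator)
  also have "\<dots> \<le> (\<integral>\<^sup>+a. indicator {a. \<not> P a} a + ennreal c \<partial>A)"
  proof (intro nn_integral_mono_AE, unfold AE_measure_pmf_iff, intro ballI)
    fix a assume a: "a \<in> set_pmf A"
    show "emeasure B {b. Q a b} \<le> indicator {a. \<not> P a} a + ennreal c"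
    proof (cases "P a")
      case True
      then show ?thesis using assms(1)[OF a]
        by (simp add: measure_pmf.emeasure_eq_measure ennreal_leI)
    next
      case False
      have "emeasure B {b. Q a b} \<le> 1" by (rule measure_pmf.emeasure_le_1)
      also have "\<dots> \<le> 1 + ennreal c" by simp
      finally show ?thesis using False by simp
    qed
  qed
  also have "\<dots> = emeasure A {a. \<not> P a} + ennreal c"
    by (simp add: nn_integral_add)
  finally show ?thesis
    using assms(2)
    by (simp add: measure_pmf.emeasure_eq_measure flip: ennreal_plus)
qed

text \<open>
Choice of parameters. Unless \<open>\<Gamma>\<close> has at least three times its expected size, which happens with
probability at most \<open>exp (- N * p)\<close>, the frame vectors have squared norm at most \<open>R = card \<Gamma> * \<mu>\<^sup>2\<close>, of order at most
\<open>1 / X\<close>, while \<open>q \<le> 1 / 100\<close> because \<open>N * \<mu>\<^sup>2 \<ge> 1\<close>. With \<open>K = 1 / 8\<close> the moment bound then survives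
up to powers of order \<open>X\<close>, and the power trace method loses only the dimension factor \<open>N\<close>
against \<open>(2 * K) ^ X \<le> exp (- X)\<close>.
\<close>
lemma prob_pair_concentrated_on_le:
  assumes \<Phi>: "orthonormal_basis N \<Phi>" and \<Psi>: "orthonormal_basis N \<Psi>"
    and p: "p \<in> {0..1}" and q: "q \<in> {0..1}"
    and N: "0 < N" and X: "1 \<le> X" "X \<le> real N * p"
    and sparse: "real N * (p + q) * (mutual_incoherence N \<Phi> \<Psi>)\<^sup>2 \<le> 1 / (100 * X)"
  shows "measure_pmf.prob (pair_pmf (random_subset N p) (random_subset N q))
    {(\<Gamma>, T). concentrated_on N \<Phi> \<Psi> \<Gamma> T} \<le> 2 * (real N * exp (- X))"
proof -
  let ?\<mu> = "mutual_incoherence N \<Phi> \<Psi>"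
  have sparse': "real N * ?\<mu>\<^sup>2 * p + real N * ?\<mu>\<^sup>2 * q \<le> 1 / (100 * X)"
    using sparse by (simp add: algebra_simps)
  have pos: "0 \<le> real N * ?\<mu>\<^sup>2 * p" "0 \<le> real N * ?\<mu>\<^sup>2 * q" using p q by auto
  have q_le: "q \<le> 1 / 100"
  proof -
    have "q \<le> real N * ?\<mu>\<^sup>2 * q"
      using mult_right_mono[OF mutual_incoherence_ge[OF \<Phi> \<Psi> N], of q] q by simp
    also have "\<dots> \<le> 1 / (100 * X)" using sparse' pos by linarith
    also have "\<dots> \<le> 1 / 100" using X(1) by (intro divide_left_mono) auto
    finally show ?thesis .
  qed
  \<comment> \<open>An odd power of size about \<open>X\<close>; rounding costs at most \<open>3\<close>, which \<open>X \<ge> 1\<close> absorbs.\<close>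
  define l where "l = Suc (2 * nat \<lceil>X / 2\<rceil>)"
  have l: "odd l" "X \<le> real l" "real l \<le> 4 * X"
    using X(1) of_int_ceiling_le_add_one[of "X / 2"] le_of_int_ceiling[of "X / 2"]
    by (simp_all add: l_def, linarith+)
  have cond: "q / (1 - q) * (real (card \<Gamma>) * ?\<mu>\<^sup>2 + 1 / 8) ^ m \<le> (1 / 8) ^ Suc m"
    if card: "real (card \<Gamma>) < 3 * (real N * p)" and m: "m < l" for \<Gamma> :: "nat set" and m
  proof -
    let ?R = "real (card \<Gamma>) * ?\<mu>\<^sup>2"
    have "?R \<le> 3 * (real N * p) * ?\<mu>\<^sup>2" using card by (intro mult_right_mono) auto
    also have "\<dots> = 3 * (real N * ?\<mu>\<^sup>2 * p)" by simp
    also have "\<dots> \<le> 3 / (100 * X)" using sparse' pos by simp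
    finally have R: "?R \<le> 3 / (100 * X)" .
    \<comment> \<open>Since \<open>R + K = (1 + 8 * R) / 8\<close>, the condition asks that \<open>(1 + 8 * R) ^ m\<close> stay bounded.\<close>
    have "real m * (8 * ?R) \<le> (4 * X) * (8 * (3 / (100 * X)))"
      using m l(3) R by (intro mult_mono) auto
    also have "\<dots> \<le> 1" using X(1) by simp
    finally have mR: "real m * (8 * ?R) \<le> 1" .
    have "(1 + 8 * ?R) ^ m \<le> exp (8 * ?R) ^ m" by (intro power_mono) auto
    also have "\<dots> = exp (real m * (8 * ?R))" by (simp only: exp_of_nat_mult)
    also have "\<dots> \<le> exp 1" using mR by simp
    finally have "(1 + 8 * ?R) ^ m \<le> exp 1" .
    then have "q / (1 - q) * (1 + 8 * ?R) ^ m \<le> (1 / 99) * exp 1"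
      using q q_le by (intro mult_mono) (auto simp: field_simps)
    also have "\<dots> \<le> 1 / 8" using e_less_272 by simp
    finally have "q / (1 - q) * (1 + 8 * ?R) ^ m * (1 / 8) ^ m \<le> 1 / 8 * (1 / 8) ^ m"
      by (rule mult_right_mono) simp
    also have "q / (1 - q) * (1 + 8 * ?R) ^ m * (1 / 8) ^ m = q / (1 - q) * ((1 + 8 * ?R) * (1 / 8)) ^ m"
      by (simp only: power_mult_distrib mult.assoc)
    also have "(1 + 8 * ?R) * (1 / 8) = ?R + 1 / 8" by (simp add: algebra_simps)
    finally show ?thesis by simp
  qed
  have quarter: "(2 * (1 / 8) :: real) ^ l \<le> exp (- X)"
  proof -
    have "(2 * (1 / 8) :: real) ^ l \<le> exp (- 1) ^ l"
      using e_less_272 by (intro power_mono) (auto simp: exp_minus field_simps)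
    also have "\<dots> = exp (- real l)" by (simp flip: exp_of_nat_mult)
    also have "\<dots> \<le> exp (- X)" using l(2) by simp
    finally show ?thesis .
  qed
  have "measure_pmf.prob (pair_pmf (random_subset N p) (random_subset N q))
      {(\<Gamma>, T). concentrated_on N \<Phi> \<Psi> \<Gamma> T} \<le>
      measure_pmf.prob (random_subset N p) {\<Gamma>. \<not> real (card \<Gamma>) < 3 * (real N * p)} + real N * exp (- X)"
  proof (rule prob_pair_pmf_le)
    fix \<Gamma> assume \<Gamma>: "\<Gamma> \<in> set_pmf (random_subset N p)" and card: "real (card \<Gamma>) < 3 * (real N * p)"
    have "measure_pmf.prob (random_subset N q) {T. concentrated_on N \<Phi> \<Psi> \<Gamma> T} \<le> real N * (2 * (1 / 8)) ^ l"
      using \<Gamma> set_pmf_random_subset[of N p] q q_le l(1) cond[OF card]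
      by (intro prob_concentrated_on_le[OF \<Phi> \<Psi>]) auto
    also have "\<dots> \<le> real N * exp (- X)" using quarter by (rule mult_left_mono) simp
    finally show "measure_pmf.prob (random_subset N q) {T. concentrated_on N \<Phi> \<Psi> \<Gamma> T} \<le> real N * exp (- X)" .
  qed simp
  also have "measure_pmf.prob (random_subset N p) {\<Gamma>. \<not> real (card \<Gamma>) < 3 * (real N * p)} \<le> exp (- (real N * p))"
    using prob_card_random_subset_ge[OF p] by (simp add: not_less)
  also have "exp (- (real N * p)) \<le> real N * exp (- X)"
  proof -
    have "exp (- (real N * p)) \<le> exp (- X)" using X(2) by simp
    also have "\<dots> \<le> real N * exp (- X)" using N by simp
    finally show ?thesis .
  qed
  finally show ?thesis by simp
qed

theorem theorem5p1:
  shows "\<exists>C1::real. C1 > 0 \<and> (\<forall>\<beta>::real. \<beta> \<ge> 1 \<longrightarrow> (\<exists>C::real. C > 0 \<and>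
    (\<forall>(N::nat) (\<Phi>1::nat \<Rightarrow> complex vec) (\<Phi>2::nat \<Rightarrow> complex vec) (p1::real) (p2::real).
      N \<ge> 512 \<longrightarrow>
      orthonormal_basis N \<Phi>1 \<longrightarrow> orthonormal_basis N \<Phi>2 \<longrightarrow>
      p1 \<in> {0..1} \<longrightarrow> p2 \<in> {0..1} \<longrightarrow>
      (let \<mu> = mutual_incoherence N \<Phi>1 \<Phi>2;
           G1 = random_subset N p1;
           G2 = random_subset N p2
       in
        \<mu> \<le> 1 / sqrt (2 * (\<beta> + 1) * ln (real N)) \<longrightarrow>
        min (expected_size G1) (expected_size G2) \<ge> 4 * (\<beta> + 1) * ln (real N) \<longrightarrow>
        expected_size G1 + expected_size G2
          \<le> C1 / (\<mu>\<^sup>2 * ((\<beta> + 1) * ln (real N)) powr (5 / 2)) \<longrightarrow>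
        measure_pmf.prob (pair_pmf G1 G2)
          {(\<Gamma>1, \<Gamma>2).
            (\<forall>f \<in> carrier_vec N. vec_supported_on (coeffs_in N \<Phi>1 f) \<Gamma>1 \<longrightarrow>
               (vec_l2norm (restrict_to \<Gamma>2 (coeffs_in N \<Phi>2 f)))\<^sup>2 \<le> (vec_l2norm f)\<^sup>2 / 2) \<and>
            (\<forall>f \<in> carrier_vec N. vec_supported_on (coeffs_in N \<Phi>2 f) \<Gamma>2 \<longrightarrow>
               (vec_l2norm (restrict_to \<Gamma>1 (coeffs_in N \<Phi>1 f)))\<^sup>2 \<le> (vec_l2norm f)\<^sup>2 / 2) \<and>
            \<not> (\<exists>f \<in> carrier_vec N. f \<noteq> 0\<^sub>v N \<and>
                 vec_supported_on (coeffs_in N \<Phi>1 f) \<Gamma>1 \<and>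
                 vec_supported_on (coeffs_in N \<Phi>2 f) \<Gamma>2)}
          \<ge> 1 - C * ln (real N) * real N powr (- \<beta>)))))"
  \<comment> \<open>The witness \<open>4\<close> for \<open>C\<close> counts two failure events in each of the two directions.\<close>
proof (rule exI[of _ "1 / 100 :: real"], intro conjI allI impI, simp,
    rule exI[of _ "4 :: real"], intro conjI allI impI, simp, goal_cases)
  case (1 \<beta> N \<Phi>1 \<Phi>2 p1 p2)
  note \<beta> = \<open>\<beta> \<ge> 1\<close> and bases = \<open>orthonormal_basis N \<Phi>1\<close> \<open>orthonormal_basis N \<Phi>2\<close>
    and p = \<open>p1 \<in> {0..1}\<close> \<open>p2 \<in> {0..1}\<close>
  let ?G1 = "random_subset N p1" and ?G2 = "random_subset N p2"
  let ?\<mu> = "mutual_incoherence N \<Phi>1 \<Phi>2"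
  let ?L = "ln (real N)"
  define X where "X = (\<beta> + 1) * ?L"
  define good where "good = (\<lambda>\<Gamma>1 \<Gamma>2.
    (\<forall>f \<in> carrier_vec N. vec_supported_on (coeffs_in N \<Phi>1 f) \<Gamma>1 \<longrightarrow>
       (vec_l2norm (restrict_to \<Gamma>2 (coeffs_in N \<Phi>2 f)))\<^sup>2 \<le> (vec_l2norm f)\<^sup>2 / 2) \<and>
    (\<forall>f \<in> carrier_vec N. vec_supported_on (coeffs_in N \<Phi>2 f) \<Gamma>2 \<longrightarrow>
       (vec_l2norm (restrict_to \<Gamma>1 (coeffs_in N \<Phi>1 f)))\<^sup>2 \<le> (vec_l2norm f)\<^sup>2 / 2) \<and>
    \<not> (\<exists>f \<in> carrier_vec N. f \<noteq> 0\<^sub>v N \<and>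
         vec_supported_on (coeffs_in N \<Phi>1 f) \<Gamma>1 \<and> vec_supported_on (coeffs_in N \<Phi>2 f) \<Gamma>2))"
  have "exp 1 \<le> real N" using e_less_272 \<open>N \<ge> 512\<close> by linarith
  then have L1: "1 \<le> ?L" using \<open>N \<ge> 512\<close> by (simp add: ln_ge_iff)
  have N: "0 < N" using \<open>N \<ge> 512\<close> by simp
  have "1 * 1 \<le> X" unfolding X_def using \<beta> L1 by (intro mult_mono) auto
  then have X1: "1 \<le> X" by simp
  note commute = mutual_incoherence_commute[OF bases]
  have "\<bar>?\<mu>\<bar> > 0" using mutual_incoherence_ge[OF bases N] by (cases "?\<mu> = 0") auto
  then have \<mu>: "0 < ?\<mu>\<^sup>2" by simp
  show ?case
    unfolding Let_def good_def[symmetric]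
  proof (intro impI)
    assume "4 * (\<beta> + 1) * ?L \<le> min (expected_size ?G1) (expected_size ?G2)"
    then have "4 * X \<le> real N * p1" "4 * X \<le> real N * p2"
      using p by (simp_all add: expected_size_random_subset X_def algebra_simps)
    then have large: "X \<le> real N * p1" "X \<le> real N * p2" using X1 by linarith+
    assume "expected_size ?G1 + expected_size ?G2 \<le> (1 / 100) / (?\<mu>\<^sup>2 * ((\<beta> + 1) * ?L) powr (5 / 2))"
    then have "real N * (p1 + p2) \<le> (1 / 100) / (?\<mu>\<^sup>2 * X powr (5 / 2))"
      using p by (simp add: expected_size_random_subset X_def algebra_simps)
    also have "\<dots> \<le> (1 / 100) / (?\<mu>\<^sup>2 * X powr 1)"
      using \<mu> X1 by (intro divide_left_mono mult_left_mono powr_mono mult_pos_pos) auto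
    finally have sparse: "real N * (p1 + p2) * ?\<mu>\<^sup>2 \<le> 1 / (100 * X)"
      using \<mu> X1 by (simp add: field_simps)
    let ?bad1 = "{(\<Gamma>1, \<Gamma>2). concentrated_on N \<Phi>1 \<Phi>2 \<Gamma>1 \<Gamma>2}"
    let ?bad2 = "{(\<Gamma>1, \<Gamma>2). concentrated_on N \<Phi>2 \<Phi>1 \<Gamma>2 \<Gamma>1}"
    let ?P = "measure_pmf.prob (pair_pmf ?G1 ?G2)"
    have "?P ?bad1 \<le> 2 * (real N * exp (- X))"
      using bases p N X1 large(1) sparse by (rule prob_pair_concentrated_on_le)
    moreover have "?P ?bad2 \<le> 2 * (real N * exp (- X))"
    proof -
      have "?P ?bad2 = measure_pmf.prob (pair_pmf ?G2 ?G1) {(\<Gamma>, T). concentrated_on N \<Phi>2 \<Phi>1 \<Gamma> T}"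
        by (subst pair_commute_pmf) (simp add: vimage_def case_prod_unfold)
      also have "\<dots> \<le> 2 * (real N * exp (- X))"
        using bases(2,1) p(2,1) N X1 large(2)
        by (rule prob_pair_concentrated_on_le) (use sparse in \<open>simp add: commute add.commute\<close>)
      finally show ?thesis .
    qed
    moreover have "?P (?bad1 \<union> ?bad2) \<le> ?P ?bad1 + ?P ?bad2"
      by (rule measure_Un_le) auto
    ultimately have bad: "?P (?bad1 \<union> ?bad2) \<le> 4 * (real N * exp (- X))" by simp
    have "real N * exp (- X) = real N powr 1 * real N powr (- (\<beta> + 1))"
      using N by (simp add: X_def powr_def algebra_simps)
    also have "\<dots> = real N powr (- \<beta>)" by (subst powr_add[symmetric]) simp
    finally have "real N * exp (- X) = real N powr (- \<beta>)" .
    moreover have "real N powr (- \<beta>) \<le> ?L * real N powr (- \<beta>)"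
      using mult_right_mono[OF L1, of "real N powr (- \<beta>)"] by simp
    ultimately have "1 - 4 * ?L * real N powr (- \<beta>) \<le> 1 - ?P (?bad1 \<union> ?bad2)" using bad by simp
    also have "\<dots> = ?P (- (?bad1 \<union> ?bad2))"
      using measure_pmf.prob_compl[of "?bad1 \<union> ?bad2" "pair_pmf ?G1 ?G2"] by (simp add: Compl_eq_Diff_UNIV)
    also have "\<dots> \<le> ?P {(\<Gamma>1, \<Gamma>2). good \<Gamma>1 \<Gamma>2}"
    proof (intro measure_pmf.finite_measure_mono_AE, unfold AE_measure_pmf_iff, intro ballI impI)
      fix \<Gamma> assume "\<Gamma> \<in> set_pmf (pair_pmf ?G1 ?G2)" "\<Gamma> \<in> - (?bad1 \<union> ?bad2)"
      moreover obtain \<Gamma>1 \<Gamma>2 where \<Gamma>: "\<Gamma> = (\<Gamma>1, \<Gamma>2)" by (cases \<Gamma>)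
      ultimately have ok: "\<not> concentrated_on N \<Phi>1 \<Phi>2 \<Gamma>1 \<Gamma>2" "\<not> concentrated_on N \<Phi>2 \<Phi>1 \<Gamma>2 \<Gamma>1"
        by auto
      have "f = 0\<^sub>v N" if f: "f \<in> carrier_vec N" and s1: "vec_supported_on (coeffs_in N \<Phi>1 f) \<Gamma>1"
        and s2: "vec_supported_on (coeffs_in N \<Phi>2 f) \<Gamma>2" for f
      proof -
        have "restrict_to \<Gamma>2 (coeffs_in N \<Phi>2 f) = coeffs_in N \<Phi>2 f"
          using s2 by (intro eq_vecI) (auto simp: restrict_to_def vec_supported_on_def coeffs_in_def)
        moreover have "(vec_l2norm (coeffs_in N \<Phi>2 f))\<^sup>2 = (vec_l2norm f)\<^sup>2"
          unfolding vec_l2norm_sq_coeffs_in[OF bases(2) f] unfolding vec_l2norm_sq by (simp add: coeffs_in_def)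
        moreover have "(vec_l2norm (restrict_to \<Gamma>2 (coeffs_in N \<Phi>2 f)))\<^sup>2 \<le> (vec_l2norm f)\<^sup>2 / 2"
          using ok(1) f s1 by (auto simp: concentrated_on_def not_less)
        ultimately have "(vec_l2norm f)\<^sup>2 \<le> (vec_l2norm f)\<^sup>2 / 2" by simp
        then have "(vec_l2norm f)\<^sup>2 = 0"
          using zero_le_power2[of "vec_l2norm f"] by linarith
        then have "(\<Sum>i<N. (cmod (f $ i))\<^sup>2) = 0" using f unfolding vec_l2norm_sq by simp
        then have "f $ i = 0" if "i < N" for i
          using that by (simp add: sum_nonneg_eq_0_iff)
        then show ?thesis using f by (intro eq_vecI) auto
      qed
      then have "good \<Gamma>1 \<Gamma>2"
        using ok unfolding good_def concentrated_on_def not_less[symmetric] by blast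
      then show "\<Gamma> \<in> {(\<Gamma>1, \<Gamma>2). good \<Gamma>1 \<Gamma>2}" by (simp add: \<Gamma>)
    qed auto
    finally show "1 - 4 * ?L * real N powr (- \<beta>) \<le> ?P {(\<Gamma>1, \<Gamma>2). good \<Gamma>1 \<Gamma>2}" .
  qed
qed

end
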